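(* If $x$ is a precisely almost periodic sequence and $y$ is a periodic sequence (over finite alphabets), then $x\times y$ is precisely almost periodic.
   Context: Sequences over a finite alphabet $A$ are maps $\mathbb{N}\to A$; $x[i,j]=x(i)\dots x(j)$. $y$ is periodic if there is $T\geqslant1$ with $y(i)=y(i+T)$ for all $i$. $x$ is precisely almost periodic if for every finite word $u$ occurring in $x$ there exist $a\in\mathbb{N}$ and $d\geqslant1$ such that $x[a+id,\,a+id+|u|-1]=u$ for all $i\geqslant0$. For $x\in A^{\mathbb{N}}$, $y\in B^{\mathbb{N}}$ the product $x\times y\in(A\times B)^{\mathbb{N}}$ is $(x\times y)(i)=\langle x(i),y(i)\rangle$. *)

theory Defs
  imports Main "HOL-Library.Omega_Words_Fun"
begin

definition periodic :: "'a word \<Rightarrow> bool" where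
  "periodic y \<longleftrightarrow> (\<exists>T\<ge>1. \<forall>i. y i = y (i + T))"

text \<open>
  The library's \<open>x [i \<rightarrow> j]\<close> is half-open: it is the list \<open>[x i, \<dots>, x (j - 1)]\<close>, so
  \<open>x [i \<rightarrow> i + length u]\<close> is the word of length \<open>length u\<close> at position \<open>i\<close>.
\<close>

definition occurs_at :: "'a list \<Rightarrow> 'a word \<Rightarrow> nat \<Rightarrow> bool" where
  "occurs_at u x i \<longleftrightarrow> x [i \<rightarrow> i + length u] = u"

definition precisely_almost_periodic :: "'a word \<Rightarrow> bool" where
  "precisely_almost_periodic x \<longleftrightarrow>
     (\<forall>u. (\<exists>i. occurs_at u x i) \<longrightarrow>
          (\<exists>a. \<exists>d\<ge>1. \<forall>i. occurs_at u x (a + i * d)))"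

definition seq_prod :: "'a word \<Rightarrow> 'b word \<Rightarrow> ('a \<times> 'b) word" where
  "seq_prod x y = (\<lambda>i. (x i, y i))"

end

theory Submission
  imports Defs
begin

text \<open>
  Let \<open>T\<close> be a period of \<open>y\<close>, let \<open>v\<close> be a word of \<open>x\<close>, and let \<open>R\<close> be the set of residues modulo
  \<open>T\<close> of the occurrences of \<open>v\<close> in \<open>x\<close>. A long prefix \<open>w\<close> of \<open>x\<close> contains occurrences of \<open>v\<close> in all
  classes of \<open>R\<close>. If \<open>w\<close> occurs at \<open>a + i * d\<close> for all \<open>i\<close>, then \<open>a + R \<subseteq> R\<close>; by finiteness
  \<open>a + R = R\<close>. Hence for every class in \<open>R\<close> there is an offset inside \<open>w\<close> at which \<open>v\<close> occurs and
  which \<open>a\<close> shifts to that class, and so \<open>v\<close> occurs in that class along a progression of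
  difference \<open>d * T\<close>.
\<close>

lemma occurs_at_iff_nth: "occurs_at u x i \<longleftrightarrow> (\<forall>j<length u. x (i + j) = u ! j)"
  unfolding occurs_at_def list_eq_iff_nth_eq by simp

lemma occurs_at_seq_prod_iff:
  "occurs_at u (seq_prod x y) i \<longleftrightarrow> occurs_at (map fst u) x i \<and> occurs_at (map snd u) y i"
  by (auto simp: occurs_at_iff_nth seq_prod_def prod_eq_iff)

lemma occurs_at_within:
  assumes "occurs_at (x [0 \<rightarrow> n]) x b" "occurs_at v x q" "q + length v \<le> n"
  shows "occurs_at v x (b + q)"
  unfolding occurs_at_iff_nth
proof (intro allI impI)
  fix j assume "j < length v"
  then have "q + j < n" using assms(3) by simp
  then have "x (b + (q + j)) = x (q + j)"
    using assms(1) unfolding occurs_at_iff_nth by fastforce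
  moreover have "x (q + j) = v ! j"
    using assms(2) \<open>j < length v\<close> unfolding occurs_at_iff_nth by blast
  ultimately show "x (b + q + j) = v ! j" by (simp add: add.assoc)
qed

lemma period_mod_eq:
  fixes y :: "'a word"
  assumes "\<forall>i. y i = y (i + T)" "i mod T = j mod T"
  shows "y i = y j"
proof -
  have mult: "y (r + k * T) = y r" for r k
  proof (induction k)
    case (Suc k)
    have "y (r + Suc k * T) = y (r + k * T + T)" by (simp add: ac_simps)
    then show ?case using assms(1) Suc by metis
  qed simp
  have "y k = y (k mod T)" for k
    using mult[of "k mod T" "k div T"] by simp
  then show ?thesis using assms(2) by metis
qed

lemma occurs_at_period_mod:
  assumes "\<forall>i. y i = y (i + T)" "occurs_at v y p" "q mod T = p mod T"
  shows "occurs_at v y q"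
proof -
  have "y (q + j) = y (p + j)" for j
    using assms(1,3) by (intro period_mod_eq[of y T]) (auto intro: mod_add_cong)
  then show ?thesis using assms(2) by (simp add: occurs_at_iff_nth)
qed

text \<open>There are finitely many classes modulo \<open>T\<close>, so one witness per inhabited
  class suffices.\<close>

lemma bounded_residue_witness:
  fixes P :: "nat \<Rightarrow> bool"
  assumes "T \<ge> 1"
  obtains N where "\<And>q. P q \<Longrightarrow> \<exists>q'\<le>N. P q' \<and> q' mod T = q mod T"
proof -
  define f where "f r = (SOME q. P q \<and> q mod T = r)" for r
  have "\<exists>q'\<le>(\<Sum>r<T. f r). P q' \<and> q' mod T = q mod T" if "P q" for q
  proof -
    have "P (f (q mod T)) \<and> f (q mod T) mod T = q mod T"
      unfolding f_def by (rule someI[of _ q]) (use that in simp)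
    \<comment> \<open>The sum is a crude common upper bound, since all summands are natural
      numbers.\<close>
    moreover have "f (q mod T) \<le> (\<Sum>r<T. f r)"
      using assms by (intro member_le_sum) auto
    ultimately show ?thesis by blast
  qed
  then show thesis using that by blast
qed

lemma precisely_almost_periodic_residue:
  assumes pap: "precisely_almost_periodic x" and v: "occurs_at v x p" and T: "T \<ge> 1"
  obtains a d where "d \<ge> 1" "\<And>i. occurs_at v x (a + i * d)" "\<And>i. (a + i * d) mod T = p mod T"
proof -
  obtain N where N: "\<And>q. occurs_at v x q \<Longrightarrow> \<exists>q'\<le>N. occurs_at v x q' \<and> q' mod T = q mod T"
    using bounded_residue_witness[OF T, of "occurs_at v x"] by blast
  \<comment> \<open>Adding \<open>length v\<close> makes every occurrence of \<open>v\<close>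
    starting at or before \<open>N\<close> fit inside the prefix.\<close>
  let ?w = "x [0 \<rightarrow> N + length v]"
  have "occurs_at ?w x 0" by (simp add: occurs_at_def)
  then obtain a d where d: "d \<ge> 1" and w: "\<And>i. occurs_at ?w x (a + i * d)"
    using pap unfolding precisely_almost_periodic_def by blast
  have shift: "occurs_at v x (a + i * d + q)" if "occurs_at v x q" "q \<le> N" for i q
    using occurs_at_within[OF w that(1)] that(2) by simp
  have class_shift: "\<exists>q\<le>N. occurs_at v x q \<and> q mod T = (p + k * a) mod T" for k
  proof (induction k)
    case 0
    then show ?case using N[OF v] by simp
  next
    case (Suc k)
    then obtain q where q: "q \<le> N" "occurs_at v x q" "q mod T = (p + k * a) mod T" by blast
    \<comment> \<open>The shifted occurrence may start beyond \<open>N\<close>; it is traded for one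
      of the same class within the bound, so that it can be shifted again.\<close>
    have "occurs_at v x (a + q)" using shift[OF q(2,1), of 0] by simp
    then obtain q' where "q' \<le> N" "occurs_at v x q'" "q' mod T = (a + q) mod T"
      using N by blast
    moreover have "(a + q) mod T = (p + Suc k * a) mod T"
      using mod_add_cong[OF refl q(3), of a] by (simp add: ac_simps)
    ultimately show ?case by auto
  qed
  \<comment> \<open>\<open>T - 1\<close> steps by \<open>a\<close> invert one step modulo \<open>T\<close>.\<close>
  obtain q where q: "q \<le> N" "occurs_at v x q" "q mod T = (p + (T - 1) * a) mod T"
    using class_shift by blast
  have "(a + q) mod T = (a + (p + (T - 1) * a)) mod T"
    using q(3) by (intro mod_add_cong) auto
  also have "a + (p + (T - 1) * a) = p + a * T"
    using T by (cases T) (auto simp: algebra_simps)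
  finally have "(a + q) mod T = p mod T" by simp
  then have residue: "(a + q + i * (d * T)) mod T = p mod T" for i
    by (simp flip: mult.assoc)
  \<comment> \<open>Keeping only every \<open>T\<close>-th copy of the prefix freezes the
    residue.\<close>
  have "occurs_at v x (a + q + i * (d * T))" for i
    using shift[OF q(2,1), of "i * T"] by (simp add: ac_simps)
  moreover have "d * T \<ge> 1" using d T by simp
  ultimately show thesis using residue by (intro that)
qed

theorem theorem17:
  fixes x :: "nat \<Rightarrow> 'a::finite" and y :: "nat \<Rightarrow> 'b::finite"
  assumes "precisely_almost_periodic x" and "periodic y"
  shows "precisely_almost_periodic (seq_prod x y)"
  unfolding precisely_almost_periodic_def
proof (intro allI impI)
  fix u :: "('a \<times> 'b) list"
  assume "\<exists>p. occurs_at u (seq_prod x y) p"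
  then obtain p where p: "occurs_at (map fst u) x p" "occurs_at (map snd u) y p"
    by (auto simp: occurs_at_seq_prod_iff)
  obtain T where T: "T \<ge> 1" "\<forall>i. y i = y (i + T)"
    using assms(2) unfolding periodic_def by blast
  obtain a d where d: "d \<ge> 1" and x: "\<And>i. occurs_at (map fst u) x (a + i * d)"
    and residue: "\<And>i. (a + i * d) mod T = p mod T"
    by (rule precisely_almost_periodic_residue[OF assms(1) p(1) T(1)]) (rule that)
  have "occurs_at (map snd u) y (a + i * d)" for i
    using occurs_at_period_mod[OF T(2) p(2) residue] .
  with x have "\<forall>i. occurs_at u (seq_prod x y) (a + i * d)"
    by (simp add: occurs_at_seq_prod_iff)
  with d show "\<exists>a. \<exists>d\<ge>1. \<forall>i. occurs_at u (seq_prod x y) (a + i * d)"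
    by blast
qed

end
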